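(* Let $\mathbf{X},\mathbf{Y},\mathbf{Z}$ be finite nonempty sets, and let $b^{\mathtt y}\in\mathbb{R}^{\mathbf{X}\times\mathbf{Y}}$ and $b^{\mathtt z}\in\mathbb{R}^{\mathbf{X}\times\mathbf{Z}}$ be the $(X,Y)$- and $(X,Z)$-marginals of a probability distribution on $\mathbf{X}\times\mathbf{Y}\times\mathbf{Z}$. Consider the exponential cone program (EXP), with variables $r,p,q\in\mathbb{R}^{\mathbf{X}\times\mathbf{Y}\times\mathbf{Z}}$: $$\text{minimize } -\sum_{x,y,z} r_{x,y,z}$$ subject to $q_{x,y,*}=b^{\mathtt y}_{x,y}$ for all $(x,y)$, $q_{x,*,z}=b^{\mathtt z}_{x,z}$ for all $(x,z)$, $q_{*,y,z}-p_{x,y,z}=0$ for all $(x,y,z)$, and $(r_{x,y,z},p_{x,y,z},q_{x,y,z})\in\mathcal{K}_{\exp}$ for all $(x,y,z)$; and its dual problem (D-EXP), with variables $\lambda^{\mathtt y}\in\mathbb{R}^{\mathbf{X}\times\mathbf{Y}}$, $\lambda^{\mathtt z}\in\mathbb{R}^{\mathbf{X}\times\mathbf{Z}}$, and $\mu\in\mathbb{R}^{\mathbf{X}\times\mathbf{Y}\times\mathbf{Z}}$ with all entries negative: $$\text{maximize } -\sum_{x,y}\lambda^{\mathtt y}_{x,y}b^{\mathtt y}_{x,y}-\sum_{x,z}\lambda^{\mathtt z}_{x,z}b^{\mathtt z}_{x,z}$$ subject to $\lambda^{\mathtt y}_{x,y}+\lambda^{\mathtt z}_{x,z}+\mu_{*,y,z}+1+\ln(-\mu_{x,y,z})\ge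 0$ for all $(x,y,z)\in\mathbf{X}\times\mathbf{Y}\times\mathbf{Z}$. Then strong duality holds for the primal-dual pair (EXP), (D-EXP). That is, for every feasible solution $(r,p,q)$ of (EXP) and every feasible solution $(\lambda^{\mathtt y},\lambda^{\mathtt z},\mu)$ of (D-EXP), $(r,p,q)$ is optimal for (EXP) and $(\lambda^{\mathtt y},\lambda^{\mathtt z},\mu)$ is optimal for (D-EXP) if and only if the duality gap $$d=-\sum_{x,y,z} r_{x,y,z}+\sum_{x,y}\lambda^{\mathtt y}_{x,y}b^{\mathtt y}_{x,y}+\sum_{x,z}\lambda^{\mathtt z}_{x,z}b^{\mathtt z}_{x,z}$$ is zero.
   Context: An asterisk in an index position denotes summation over that index, e.g. $q_{x,y,*}=\sum_{z\in\mathbf{Z}}q_{x,y,z}$, $q_{x,*,z}=\sum_{y\in\mathbf{Y}}q_{x,y,z}$, $q_{*,y,z}=\sum_{x\in\mathbf{X}}q_{x,y,z}$, $\mu_{*,y,z}=\sum_{x\in\mathbf{X}}\mu_{x,y,z}$. The marginals of a probability distribution $P\in\mathbb{R}^{\mathbf{X}\times\mathbf{Y}\times\mathbf{Z}}$ are $b^{\mathtt y}_{x,y}=P_{x,y,*}$ and $b^{\mathtt z}_{x,z}=P_{x,*,z}$. The exponential cone is the closed convex cone $$\mathcal{K}_{\exp}=\{(r,p,q)\in\mathbb{R}^3 \mid q>0 \text{ and } q e^{r/q}\le p\}\cup\{(r,p,0)\in\mathbb{R}^3\mid r\le 0\text{ and }p\ge 0\}.$$ A feasible solution of a program is an assignment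 of its variables violating none of its constraints; it is optimal if it attains the minimum (for a minimization problem) or maximum (for a maximization problem) of the objective over all feasible solutions. The duality gap of a pair of feasible solutions is the primal objective value minus the dual objective value. A primal-dual pair of programs is said to satisfy strong duality when, for feasible primal and dual solutions, both are optimal in their respective programs if and only if their duality gap is zero. *)

theory Defs
  imports "HOL-Analysis.Analysis"
begin

text \<open>
  The finite nonempty index sets are type variables of class \<open>finite\<close>, and an array indexed by
  a product of them is a curried function. Sums are written over \<open>UNIV\<close> explicitly, since
  \<open>\<Sum>x. f x\<close> would denote an infinite series over \<open>nat\<close>.
\<close>

definition K_exp :: "(real \<times> real \<times> real) set" where
  "K_exp = {(r, p, q). q > 0 \<and> q * exp (r / q) \<le> p} \<union> {(r, p, q). q = 0 \<and> r \<le> 0 \<and> p \<ge> 0}"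

definition sum_xyz :: "('x::finite \<Rightarrow> 'y::finite \<Rightarrow> 'z::finite \<Rightarrow> real) \<Rightarrow> real" where
  "sum_xyz q = (\<Sum>x\<in>UNIV. \<Sum>y\<in>UNIV. \<Sum>z\<in>UNIV. q x y z)"

definition marg_xy :: "('x \<Rightarrow> 'y \<Rightarrow> 'z::finite \<Rightarrow> real) \<Rightarrow> 'x \<Rightarrow> 'y \<Rightarrow> real" where
  "marg_xy q x y = (\<Sum>z\<in>UNIV. q x y z)"

definition marg_xz :: "('x \<Rightarrow> 'y::finite \<Rightarrow> 'z \<Rightarrow> real) \<Rightarrow> 'x \<Rightarrow> 'z \<Rightarrow> real" where
  "marg_xz q x z = (\<Sum>y\<in>UNIV. q x y z)"

definition marg_yz :: "('x::finite \<Rightarrow> 'y \<Rightarrow> 'z \<Rightarrow> real) \<Rightarrow> 'y \<Rightarrow> 'z \<Rightarrow> real" where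
  "marg_yz q y z = (\<Sum>x\<in>UNIV. q x y z)"

definition prob_distribution :: "('x::finite \<Rightarrow> 'y::finite \<Rightarrow> 'z::finite \<Rightarrow> real) \<Rightarrow> bool" where
  "prob_distribution P \<longleftrightarrow> (\<forall>x y z. P x y z \<ge> 0) \<and> sum_xyz P = 1"

type_synonym ('x, 'y, 'z) exp_point =
  "('x \<Rightarrow> 'y \<Rightarrow> 'z \<Rightarrow> real) \<times> ('x \<Rightarrow> 'y \<Rightarrow> 'z \<Rightarrow> real) \<times> ('x \<Rightarrow> 'y \<Rightarrow> 'z \<Rightarrow> real)"

type_synonym ('x, 'y, 'z) dexp_point =
  "('x \<Rightarrow> 'y \<Rightarrow> real) \<times> ('x \<Rightarrow> 'z \<Rightarrow> real) \<times> ('x \<Rightarrow> 'y \<Rightarrow> 'z \<Rightarrow> real)"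

definition EXP_feasible ::
  "('x::finite \<Rightarrow> 'y::finite \<Rightarrow> real) \<Rightarrow> ('x \<Rightarrow> 'z::finite \<Rightarrow> real)
    \<Rightarrow> ('x, 'y, 'z) exp_point \<Rightarrow> bool" where
  "EXP_feasible bY bZ = (\<lambda>(r, p, q).
     (\<forall>x y. marg_xy q x y = bY x y) \<and>
     (\<forall>x z. marg_xz q x z = bZ x z) \<and>
     (\<forall>x y z. marg_yz q y z - p x y z = 0) \<and>
     (\<forall>x y z. (r x y z, p x y z, q x y z) \<in> K_exp))"

definition EXP_objective :: "('x::finite, 'y::finite, 'z::finite) exp_point \<Rightarrow> real" where
  "EXP_objective = (\<lambda>(r, p, q). - sum_xyz r)"

definition DEXP_feasible :: "('x::finite, 'y, 'z) dexp_point \<Rightarrow> bool" where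
  "DEXP_feasible = (\<lambda>(lY, lZ, \<mu>).
     (\<forall>x y z. \<mu> x y z < 0) \<and>
     (\<forall>x y z. lY x y + lZ x z + marg_yz \<mu> y z + 1 + ln (- \<mu> x y z) \<ge> 0))"

definition DEXP_objective ::
  "('x::finite \<Rightarrow> 'y::finite \<Rightarrow> real) \<Rightarrow> ('x \<Rightarrow> 'z::finite \<Rightarrow> real)
    \<Rightarrow> ('x, 'y, 'z) dexp_point \<Rightarrow> real" where
  "DEXP_objective bY bZ = (\<lambda>(lY, lZ, \<mu>).
     - (\<Sum>x\<in>UNIV. \<Sum>y\<in>UNIV. lY x y * bY x y) - (\<Sum>x\<in>UNIV. \<Sum>z\<in>UNIV. lZ x z * bZ x z))"

definition EXP_optimal ::
  "('x::finite \<Rightarrow> 'y::finite \<Rightarrow> real) \<Rightarrow> ('x \<Rightarrow> 'z::finite \<Rightarrow> real)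
    \<Rightarrow> ('x, 'y, 'z) exp_point \<Rightarrow> bool" where
  "EXP_optimal bY bZ = is_arg_min EXP_objective (EXP_feasible bY bZ)"

definition DEXP_optimal ::
  "('x::finite \<Rightarrow> 'y::finite \<Rightarrow> real) \<Rightarrow> ('x \<Rightarrow> 'z::finite \<Rightarrow> real)
    \<Rightarrow> ('x, 'y, 'z) dexp_point \<Rightarrow> bool" where
  "DEXP_optimal bY bZ = is_arg_max (DEXP_objective bY bZ) DEXP_feasible"

end

theory Submission
  imports Defs
begin

text \<open>
  Weak duality holds pointwise: on the exponential cone, \<open>q + q ln (-\<mu>) + p \<mu> \<le> -r\<close>. For the
  converse, only the optimality of the dual point matters. By Gordan's alternative, some convex
  combination of the gradients of the dual objective and of the active dual constraints vanishes
  there. The objective has positive weight in it, because adding a constant to \<open>\<lambda>\<^sup>y\<close> increases every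
  constraint. After normalising that weight to 1, the weights of the constraints form an array \<open>q\<close>
  with \<open>q = -\<mu> q\<^bsub>*,y,z\<^esub>\<close>, which together with \<open>r = -q ln (-\<mu>)\<close> is a primal solution whose value is
  the dual optimum.
\<close>

section \<open>A theorem of the alternative and a one-sided derivative test\<close>

lemma gordan_alternative:
  fixes L :: "'i \<Rightarrow> 'a::euclidean_space \<Rightarrow> real"
  assumes fin: "finite I" and ne: "I \<noteq> {}"
    and lin: "\<And>i. i \<in> I \<Longrightarrow> linear (L i)"
    and no: "\<And>d. \<exists>i\<in>I. L i d \<le> 0"
  obtains u where "\<And>i. i \<in> I \<Longrightarrow> u i \<ge> 0" "sum u I = 1" "\<And>d. (\<Sum>i\<in>I. u i * L i d) = 0"
proof -
  \<comment> \<open>\<open>g i\<close> is the gradient of \<open>L i\<close>, so the question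
    becomes whether 0 is a convex combination of gradients.\<close>
  define g where "g i = (\<Sum>b\<in>Basis. L i b *\<^sub>R b)" for i
  have g: "g i \<bullet> d = L i d" if "i \<in> I" for i d
  proof -
    have "L i d = L i (\<Sum>b\<in>Basis. (d \<bullet> b) *\<^sub>R b)"
      by (simp add: euclidean_representation)
    also have "\<dots> = (\<Sum>b\<in>Basis. (d \<bullet> b) * L i b)"
      using lin[OF that] by (simp add: linear_sum linear_scale)
    also have "\<dots> = g i \<bullet> d"
      by (simp add: g_def inner_sum_left inner_commute[of d] mult.commute)
    finally show ?thesis by simp
  qed
  \<comment> \<open>Otherwise the normal of a hyperplane separating 0 from the hull is a direction
    in which every \<open>L i\<close> is positive, against \<open>no\<close>.\<close>
  have "0 \<in> convex hull (g ` I)"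
  proof (rule ccontr)
    assume "0 \<notin> convex hull (g ` I)"
    moreover have "closed (convex hull (g ` I))"
      by (simp add: fin finite_imp_compact_convex_hull compact_imp_closed)
    ultimately obtain d c where d: "d \<bullet> 0 < c" "\<forall>v\<in>convex hull (g ` I). d \<bullet> v > c"
      using separating_hyperplane_closed_point[of "convex hull (g ` I)" 0]
      by auto
    have "L i d > 0" if "i \<in> I" for i
      using d that g[OF that, of d] hull_inc[of "g i" "g ` I" convex]
      by (force simp: inner_commute)
    with no[of d] show False
      by force
  qed
  \<comment> \<open>The weights are indexed by \<open>I\<close> and not by the vectors of the hull,
    since \<open>g\<close> may take the same value at several indices.\<close>
  moreover define S where "S = {\<Sum>i\<in>I. u i *\<^sub>R g i |u. (\<forall>i\<in>I. 0 \<le> u i) \<and> sum u I = 1}"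
  have "convex hull (g ` I) \<subseteq> S"
  proof (rule hull_minimal)
    show "g ` I \<subseteq> S"
    proof
      fix v assume "v \<in> g ` I"
      then obtain k where "k \<in> I" "v = g k" by auto
      then show "v \<in> S"
        using fin unfolding S_def
        by (auto intro!: exI[of _ "\<lambda>i. if i = k then 1 else 0"] simp: if_distrib[of "\<lambda>a. a *\<^sub>R _"] cong: if_cong)
    qed
    show "convex S"
    proof (rule convexI)
      fix v w :: 'a and s t :: real
      assume st: "0 \<le> s" "0 \<le> t" "s + t = 1" and "v \<in> S" "w \<in> S"
      then obtain a b where
        a: "\<forall>i\<in>I. 0 \<le> a i" "sum a I = 1" "v = (\<Sum>i\<in>I. a i *\<^sub>R g i)" and
        b: "\<forall>i\<in>I. 0 \<le> b i" "sum b I = 1" "w = (\<Sum>i\<in>I. b i *\<^sub>R g i)"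
        unfolding S_def by auto
      show "s *\<^sub>R v + t *\<^sub>R w \<in> S"
        unfolding S_def using a b st
        by (auto intro!: exI[of _ "\<lambda>i. s * a i + t * b i"]
            simp: sum.distrib scaleR_sum_right scaleR_add_left simp flip: sum_distrib_left)
    qed
  qed
  ultimately have "0 \<in> S" by blast
  then obtain u where u: "\<forall>i\<in>I. 0 \<le> u i" "sum u I = 1" "(\<Sum>i\<in>I. u i *\<^sub>R g i) = 0"
    unfolding S_def by auto
  show thesis
  proof
    fix d
    have "(\<Sum>i\<in>I. u i * L i d) = (\<Sum>i\<in>I. u i *\<^sub>R g i) \<bullet> d"
      by (simp add: inner_sum_left g)
    then show "(\<Sum>i\<in>I. u i * L i d) = 0"
      by (simp add: u)
  qed (use u in auto)
qed

text \<open>This keeps the dual constraints satisfied along a short step: an inactive one survives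
  by continuity, an active one because its derivative is positive.\<close>

lemma eventually_nonneg_at_right:
  fixes f :: "real \<Rightarrow> real"
  assumes der: "(f has_real_derivative D) (at 0)" and "f 0 \<ge> 0" and pos: "f 0 = 0 \<Longrightarrow> D > 0"
  shows "\<forall>\<^sub>F t in at_right 0. f t \<ge> 0"
proof (cases "f 0 = 0")
  case True
  then obtain e where "e > 0" "\<forall>h>0. h < e \<longrightarrow> f 0 < f (0 + h)"
    using DERIV_pos_inc_right[OF der] pos by auto
  with True show ?thesis
    by (auto simp: eventually_at_right_field intro!: exI[of _ e] less_imp_le)
next
  case False
  have "(f \<longlongrightarrow> f 0) (at_right 0)"
    using DERIV_isCont[OF der] by (simp add: isCont_def filterlim_at_split)
  then have "\<forall>\<^sub>F t in at_right 0. f t > 0"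
    using False assms(2) by (intro order_tendstoD) auto
  then show ?thesis
    by (rule eventually_mono) simp
qed

section \<open>Sums over triples and their marginals\<close>

lemma sum_xyz_marg_xy:
  "sum_xyz (\<lambda>x y z. q x y z * a x y) = (\<Sum>x\<in>UNIV. \<Sum>y\<in>UNIV. a x y * marg_xy q x y)"
  by (simp add: sum_xyz_def marg_xy_def sum_distrib_left mult.commute)

lemma sum_xyz_marg_xz:
  "sum_xyz (\<lambda>x y z. q x y z * a x z) = (\<Sum>x\<in>UNIV. \<Sum>z\<in>UNIV. a x z * marg_xz q x z)"
  unfolding sum_xyz_def marg_xz_def
  by (subst sum.swap) (simp add: sum_distrib_left mult.commute)

lemma sum_xyz_marg_yz:
  "sum_xyz (\<lambda>x y z. q x y z * a y z) = (\<Sum>y\<in>UNIV. \<Sum>z\<in>UNIV. a y z * marg_yz q y z)"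
proof -
  have "sum_xyz (\<lambda>x y z. q x y z * a y z) = (\<Sum>y\<in>UNIV. \<Sum>x\<in>UNIV. \<Sum>z\<in>UNIV. q x y z * a y z)"
    unfolding sum_xyz_def by (rule sum.swap)
  also have "\<dots> = (\<Sum>y\<in>UNIV. \<Sum>z\<in>UNIV. \<Sum>x\<in>UNIV. q x y z * a y z)"
    by (intro sum.cong refl sum.swap)
  finally show ?thesis
    by (simp add: marg_yz_def sum_distrib_left mult.commute)
qed

text \<open>Summing out x is self-adjoint for the pairing by \<open>sum_xyz\<close>. This trades the
  marginal of the dual variable for that of \<open>q\<close>, which is the primal
  \<open>p\<close>.\<close>

lemma sum_xyz_marg_yz_swap:
  "sum_xyz (\<lambda>x y z. q x y z * marg_yz m y z) = sum_xyz (\<lambda>x y z. m x y z * marg_yz q y z)"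
  unfolding sum_xyz_marg_yz by (simp add: mult.commute)

lemma sum_xyz_add: "sum_xyz (\<lambda>x y z. f x y z + g x y z) = sum_xyz f + sum_xyz g"
  by (simp add: sum_xyz_def sum.distrib)

lemma sum_xyz_diff: "sum_xyz (\<lambda>x y z. f x y z - g x y z) = sum_xyz f - sum_xyz g"
  by (simp add: sum_xyz_def sum_subtractf)

lemma sum_xyz_mono: "(\<And>x y z. f x y z \<le> g x y z) \<Longrightarrow> sum_xyz f \<le> sum_xyz g"
  by (simp add: sum_xyz_def sum_mono)

lemma sum_xyz_uminus: "sum_xyz (\<lambda>x y z. - f x y z) = - sum_xyz f"
  by (simp add: sum_xyz_def sum_negf)

lemma sum_xyz_triple: "sum_xyz f = (\<Sum>(x, y, z)\<in>UNIV. f x y z)"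
  by (simp add: sum_xyz_def sum.cartesian_product case_prod_beta flip: UNIV_Times_UNIV)

section \<open>Weak duality\<close>

lemma K_exp_dual_bound:
  assumes "(r, p, q) \<in> K_exp" and "\<mu> < 0"
  shows "q + q * ln (- \<mu>) + p * \<mu> \<le> - r"
proof (cases "q > 0")
  case True
  with assms have p: "q * exp (r / q) \<le> p"
    by (auto simp: K_exp_def)
  have "q + r + q * ln (- \<mu>) = q * (1 + (r / q + ln (- \<mu>)))"
    using True by (simp add: field_simps)
  \<comment> \<open>This is \<open>1 + s <= exp s\<close> at
    \<open>s = r / q + ln (- \<mu>)\<close>. Equality at \<open>s = 0\<close> explains the later
    choice of \<open>r\<close>.\<close>
  also have "\<dots> \<le> q * exp (r / q + ln (- \<mu>))"
    using True exp_ge_add_one_self by (intro mult_left_mono) auto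
  also have "\<dots> = q * exp (r / q) * (- \<mu>)"
    using assms by (simp add: exp_add)
  also have "\<dots> \<le> p * (- \<mu>)"
    using assms p by (intro mult_right_mono) auto
  finally show ?thesis by simp
next
  \<comment> \<open>On the face \<open>q = 0\<close> of the cone, the left side is
    \<open>p * \<mu>\<close>, and \<open>p * \<mu> <= 0 <= - r\<close>.\<close>
  case False
  with assms show ?thesis
    using mult_nonneg_nonpos[of p \<mu>] by (auto simp: K_exp_def)
qed

lemma K_exp_q_nonneg: "(r, p, q) \<in> K_exp \<Longrightarrow> q \<ge> 0"
  by (auto simp: K_exp_def)

text \<open>The primal marginal equations spread the dual objective over all triples, so that the
  two objectives can be compared term by term.\<close>

lemma DEXP_objective_marg:
  assumes "\<And>x y. marg_xy q x y = bY x y" "\<And>x z. marg_xz q x z = bZ x z"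
  shows "DEXP_objective bY bZ (lY, lZ, \<mu>) = sum_xyz (\<lambda>x y z. - (q x y z * (lY x y + lZ x z)))"
  by (simp add: DEXP_objective_def sum_xyz_diff sum_xyz_uminus distrib_left
      sum_xyz_marg_xy sum_xyz_marg_xz assms)

lemma weak_duality:
  assumes "EXP_feasible bY bZ (r, p, q)" and "DEXP_feasible (lY, lZ, \<mu>)"
  shows "DEXP_objective bY bZ (lY, lZ, \<mu>) \<le> EXP_objective (r, p, q)"
proof -
  have q: "marg_xy q x y = bY x y" "marg_xz q x z = bZ x z" "marg_yz q y z = p x y z"
    and K: "(r x y z, p x y z, q x y z) \<in> K_exp" for x y z
    using assms by (auto simp: EXP_feasible_def)
  have \<mu>: "\<mu> x y z < 0" and c: "lY x y + lZ x z + marg_yz \<mu> y z + 1 + ln (- \<mu> x y z) \<ge> 0" for x y z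
    using assms by (auto simp: DEXP_feasible_def)
  have "DEXP_objective bY bZ (lY, lZ, \<mu>) = sum_xyz (\<lambda>x y z. - (q x y z * (lY x y + lZ x z)))"
    using q by (intro DEXP_objective_marg)
  \<comment> \<open>Each dual constraint is multiplied by its weight \<open>q x y z\<close>, which
    is nonnegative on the cone.\<close>
  also have "\<dots> \<le> sum_xyz (\<lambda>x y z. q x y z * (1 + ln (- \<mu> x y z)) + q x y z * marg_yz \<mu> y z)"
  proof (rule sum_xyz_mono)
    fix x y z
    show "- (q x y z * (lY x y + lZ x z))
        \<le> q x y z * (1 + ln (- \<mu> x y z)) + q x y z * marg_yz \<mu> y z"
      using mult_left_mono[OF c[of x y z] K_exp_q_nonneg[OF K[of x y z]]]
      by (simp add: algebra_simps)
  qed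
  also have "\<dots> = sum_xyz (\<lambda>x y z. q x y z + q x y z * ln (- \<mu> x y z) + p x y z * \<mu> x y z)"
    unfolding sum_xyz_add sum_xyz_marg_yz_swap[of q] distrib_left q(3)[symmetric]
    by (simp add: mult.commute)
  also have "\<dots> \<le> sum_xyz (\<lambda>x y z. - r x y z)"
    using K_exp_dual_bound[OF K \<mu>] by (intro sum_xyz_mono)
  finally show ?thesis
    by (simp add: EXP_objective_def sum_xyz_uminus)
qed

section \<open>Multipliers at a dual optimum and the primal solution they yield\<close>

lemma dual_optimal_multipliers:
  fixes bY :: "'x::finite \<Rightarrow> 'y::finite \<Rightarrow> real" and bZ :: "'x \<Rightarrow> 'z::finite \<Rightarrow> real"
  assumes opt: "DEXP_optimal bY bZ (lY, lZ, \<mu>)"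
  obtains w t where
    "\<And>x y z. w x y z \<ge> 0"
    "\<And>x y z. w x y z * (lY x y + lZ x z + marg_yz \<mu> y z + 1 + ln (- \<mu> x y z)) = 0"
    "t \<ge> 0" "t + sum_xyz w = 1"
    "\<And>a b m. sum_xyz (\<lambda>x y z. w x y z * (a x y + b x z + marg_yz m y z + m x y z / \<mu> x y z))
       = - (t * DEXP_objective bY bZ (a, b, m))"
proof -
  define c where "c x y z = lY x y + lZ x z + marg_yz \<mu> y z + 1 + ln (- \<mu> x y z)" for x y z
  define A where "A = {(x, y, z). c x y z = 0}"
  \<comment> \<open>Directions are taken in a product of vector types, because the alternative is
    stated for a Euclidean space; \<open>ap\<close>, \<open>bp\<close> and \<open>mp\<close> read
    them as curried arrays.\<close>
  define ap where "ap d = (\<lambda>x y. fst d $ x $ y)" for d :: "(real^'y^'x) \<times> (real^'z^'x) \<times> (real^'z^'y^'x)"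
  define bp where "bp d = (\<lambda>x z. fst (snd d) $ x $ z)" for d :: "(real^'y^'x) \<times> (real^'z^'x) \<times> (real^'z^'y^'x)"
  define mp where "mp d = (\<lambda>x y z. snd (snd d) $ x $ y $ z)" for d :: "(real^'y^'x) \<times> (real^'z^'x) \<times> (real^'z^'y^'x)"
  \<comment> \<open>\<open>None\<close> indexes the dual objective, \<open>Some\<close> a
    constraint. The term \<open>mp d x y z / \<mu> x y z\<close> is the derivative of
    \<open>ln (- \<mu>)\<close>.\<close>
  define L where "L i d = (case i of
      None \<Rightarrow> DEXP_objective bY bZ (ap d, bp d, mp d)
    | Some (x, y, z) \<Rightarrow> ap d x y + bp d x z + marg_yz (mp d) y z + mp d x y z / \<mu> x y z)" for i d
  have feas: "DEXP_feasible (lY, lZ, \<mu>)"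
    and max: "\<And>d. DEXP_feasible d \<Longrightarrow> DEXP_objective bY bZ d \<le> DEXP_objective bY bZ (lY, lZ, \<mu>)"
    using opt by (auto simp: DEXP_optimal_def is_arg_max_def not_less)
  have \<mu>: "\<mu> x y z < 0" and c: "c x y z \<ge> 0" for x y z
    using feas by (auto simp: DEXP_feasible_def c_def)
  have lin: "linear (L i)" for i
    by (rule linearI; cases i)
       (auto simp: L_def DEXP_objective_def ap_def bp_def mp_def marg_yz_def sum.distrib
          sum_distrib_left algebra_simps add_divide_distrib)
  \<comment> \<open>If all these derivatives were positive, a short step along \<open>d\<close>
    would stay feasible and raise the objective, which is linear, by exactly
    \<open>t * L None d\<close>.\<close>
  have no: "\<exists>i\<in>insert None (Some ` A). L i d \<le> 0" for d
  proof (rule ccontr)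
    assume "\<not> (\<exists>i\<in>insert None (Some ` A). L i d \<le> 0)"
    then have pos0: "L None d > 0" and pos: "\<And>x y z. c x y z = 0 \<Longrightarrow> L (Some (x, y, z)) d > 0"
      by (auto simp: A_def not_le)
    define lY' where "lY' t x y = lY x y + t * ap d x y" for t x y
    define lZ' where "lZ' t x z = lZ x z + t * bp d x z" for t x z
    define \<mu>' where "\<mu>' t x y z = \<mu> x y z + t * mp d x y z" for t x y z
    have "\<forall>\<^sub>F t in at_right 0. \<mu>' t x y z < 0" for x y z
    proof -
      have "((\<lambda>t. \<mu>' t x y z) \<longlongrightarrow> \<mu> x y z + 0 * mp d x y z) (at_right 0)"
        unfolding \<mu>'_def by (intro tendsto_intros)
      then show ?thesis
        using \<mu>[of x y z] by (intro order_tendstoD) auto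
    qed
    moreover have "\<forall>\<^sub>F t in at_right 0.
      lY' t x y + lZ' t x z + marg_yz (\<mu>' t) y z + 1 + ln (- \<mu>' t x y z) \<ge> 0" for x y z
    proof (rule eventually_nonneg_at_right)
      show "((\<lambda>t. lY' t x y + lZ' t x z + marg_yz (\<mu>' t) y z + 1 + ln (- \<mu>' t x y z))
          has_real_derivative L (Some (x, y, z)) d) (at 0)"
        unfolding lY'_def lZ'_def \<mu>'_def marg_yz_def L_def
        using \<mu>[of x y z] by (auto intro!: derivative_eq_intros)
    qed (use c[of x y z] pos[of x y z] in \<open>simp_all add: lY'_def lZ'_def \<mu>'_def c_def marg_yz_def\<close>)
    ultimately have "\<forall>\<^sub>F t in at_right 0. DEXP_feasible (lY' t, lZ' t, \<mu>' t)"
      by (simp add: DEXP_feasible_def eventually_conj_iff eventually_all_finite)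
    then have "\<forall>\<^sub>F t in at_right 0. t > 0 \<and> DEXP_feasible (lY' t, lZ' t, \<mu>' t)"
      by (intro eventually_conj eventually_at_right_less)
    then obtain t where t: "t > 0" "DEXP_feasible (lY' t, lZ' t, \<mu>' t)"
      using eventually_happens' by (metis (no_types, lifting) trivial_limit_at_right_real)
    have "DEXP_objective bY bZ (lY' t, lZ' t, \<mu>' t)
        = DEXP_objective bY bZ (lY, lZ, \<mu>) + t * L None d"
      by (simp add: DEXP_objective_def L_def lY'_def lZ'_def sum.distrib sum_distrib_left algebra_simps)
    with max[OF t(2)] mult_pos_pos[OF t(1) pos0] show False
      by linarith
  qed
  obtain u where u: "\<And>i. i \<in> insert None (Some ` A) \<Longrightarrow> u i \<ge> 0"
      "sum u (insert None (Some ` A)) = 1"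
      "\<And>d. (\<Sum>i\<in>insert None (Some ` A). u i * L i d) = 0"
    using gordan_alternative[OF _ _ lin no] by auto
  \<comment> \<open>Extending the weights by zero to the inactive constraints gives complementary
    slackness.\<close>
  define w where "w x y z = (if c x y z = 0 then u (Some (x, y, z)) else 0)" for x y z
  have sum_I: "(\<Sum>i\<in>insert None (Some ` A). u i * f i)
      = u None * f None + sum_xyz (\<lambda>x y z. w x y z * f (Some (x, y, z)))" for f
  proof -
    have "(\<Sum>i\<in>Some ` A. u i * f i) = (\<Sum>k\<in>A. u (Some k) * f (Some k))"
      by (simp add: sum.reindex)
    also have "\<dots> = (\<Sum>k\<in>UNIV. if k \<in> A then u (Some k) * f (Some k) else 0)"
      by (simp add: sum.If_cases)
    also have "\<dots> = sum_xyz (\<lambda>x y z. w x y z * f (Some (x, y, z)))"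
      unfolding sum_xyz_triple by (intro sum.cong) (auto simp: A_def w_def)
    finally show ?thesis
      by (subst sum.insert) auto
  qed
  show thesis
  proof
    show "w x y z \<ge> 0" for x y z
      using u(1) by (auto simp: w_def A_def)
    show "w x y z * (lY x y + lZ x z + marg_yz \<mu> y z + 1 + ln (- \<mu> x y z)) = 0" for x y z
      by (simp add: w_def c_def)
    show "u None \<ge> 0"
      using u(1) by simp
    show "u None + sum_xyz w = 1"
      using u(2) sum_I[of "\<lambda>_. 1"] by simp
    fix a b m
    define d :: "(real^'y^'x) \<times> (real^'z^'x) \<times> (real^'z^'y^'x)"
      where "d = ((\<chi> x y. a x y), (\<chi> x z. b x z), (\<chi> x y z. m x y z))"
    have d: "ap d = a" "bp d = b" "mp d = m"
      by (simp_all add: d_def ap_def bp_def mp_def)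
    show "sum_xyz (\<lambda>x y z. w x y z * (a x y + b x z + marg_yz m y z + m x y z / \<mu> x y z))
       = - (u None * DEXP_objective bY bZ (a, b, m))"
      using u(3)[of d] unfolding sum_I by (simp add: L_def d)
  qed
qed

text \<open>Stationarity is tested on one block at a time: \<open>a\<close> and \<open>b\<close>
  give the marginal equations, \<open>m\<close> ties \<open>q\<close> to its marginal. Complementary
  slackness then equates the objective values.\<close>

lemma primal_from_dual_optimal:
  fixes bY :: "'x::finite \<Rightarrow> 'y::finite \<Rightarrow> real" and bZ :: "'x \<Rightarrow> 'z::finite \<Rightarrow> real"
  assumes opt: "DEXP_optimal bY bZ (lY, lZ, \<mu>)"
  obtains r p q where "EXP_feasible bY bZ (r, p, q)"
    "EXP_objective (r, p, q) = DEXP_objective bY bZ (lY, lZ, \<mu>)"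
proof -
  obtain w t where w: "\<And>x y z. w x y z \<ge> 0"
    "\<And>x y z. w x y z * (lY x y + lZ x z + marg_yz \<mu> y z + 1 + ln (- \<mu> x y z)) = 0"
    "t \<ge> 0" "t + sum_xyz w = 1"
    and stat: "\<And>a b m. sum_xyz (\<lambda>x y z. w x y z * (a x y + b x z + marg_yz m y z + m x y z / \<mu> x y z))
       = - (t * DEXP_objective bY bZ (a, b, m))"
    by (rule dual_optimal_multipliers[OF opt]) (rule that)
  have \<mu>: "\<mu> x y z < 0" for x y z
    using opt by (auto simp: DEXP_optimal_def is_arg_max_def DEXP_feasible_def)
  \<comment> \<open>In the direction raising every \<open>lY\<close> by 1 the left side is
    \<open>sum_xyz w\<close>. With \<open>t = 0\<close> it would vanish, contradicting
    \<open>t + sum_xyz w = 1\<close>.\<close>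
  have "t \<noteq> 0"
    using stat[of "\<lambda>_ _. 1" "\<lambda>_ _. 0" "\<lambda>_ _ _. 0"] w(4) by (auto simp: marg_yz_def)
  with w(3) have "t > 0" by simp
  have wY: "marg_xy w x y = t * bY x y" for x y
  proof -
    have "(\<Sum>i\<in>UNIV. \<Sum>j\<in>UNIV. a i j * (marg_xy w i j - t * bY i j)) = 0" for a
      using stat[of a "\<lambda>_ _. 0" "\<lambda>_ _ _. 0"]
      by (simp add: marg_yz_def sum_xyz_marg_xy DEXP_objective_def right_diff_distrib
          sum_subtractf sum_distrib_left mult.left_commute)
    \<comment> \<open>Testing with the residual itself gives a vanishing sum of squares; the other
      two blocks are treated likewise.\<close>
    from this[of "\<lambda>i j. marg_xy w i j - t * bY i j"] show ?thesis
      by (simp add: sum_nonneg_eq_0_iff sum_nonneg)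
  qed
  have wZ: "marg_xz w x z = t * bZ x z" for x z
  proof -
    have "(\<Sum>i\<in>UNIV. \<Sum>j\<in>UNIV. a i j * (marg_xz w i j - t * bZ i j)) = 0" for a
      using stat[of "\<lambda>_ _. 0" a "\<lambda>_ _ _. 0"]
      by (simp add: marg_yz_def sum_xyz_marg_xz DEXP_objective_def right_diff_distrib
          sum_subtractf sum_distrib_left mult.left_commute)
    from this[of "\<lambda>i j. marg_xz w i j - t * bZ i j"] show ?thesis
      by (simp add: sum_nonneg_eq_0_iff sum_nonneg)
  qed
  have wM: "w x y z = - \<mu> x y z * marg_yz w y z" for x y z
  proof -
    have "sum_xyz (\<lambda>x y z. m x y z * (marg_yz w y z + w x y z / \<mu> x y z)) = 0" for m
      using stat[of "\<lambda>_ _. 0" "\<lambda>_ _. 0" m]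
      by (simp add: DEXP_objective_def distrib_left sum_xyz_add sum_xyz_marg_yz_swap[of w]
          mult.commute[of "w _ _ _" "m _ _ _"])
    from this[of "\<lambda>x y z. marg_yz w y z + w x y z / \<mu> x y z"]
    have "marg_yz w y z + w x y z / \<mu> x y z = 0"
      by (simp add: sum_xyz_def sum_nonneg_eq_0_iff sum_nonneg)
    then show ?thesis
      using \<mu>[of x y z] by (simp add: field_simps)
  qed
  define q where "q x y z = w x y z / t" for x y z
  have qY: "marg_xy q x y = bY x y" and qZ: "marg_xz q x z = bZ x z"
    and q_yz: "marg_yz q y z = marg_yz w y z / t" for x y z
    using wY[of x y] wZ[of x z] \<open>t > 0\<close>
    by (simp_all add: q_def marg_xy_def marg_xz_def marg_yz_def flip: sum_divide_distrib)
  have q: "q x y z \<ge> 0" for x y z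
    using w(1)[of x y z] \<open>t > 0\<close> by (simp add: q_def)
  have qM: "q x y z = - \<mu> x y z * marg_yz q y z" for x y z
    using wM[of x y z] by (simp add: q_def[of x y z] q_yz)
  \<comment> \<open>For \<open>q > 0\<close> the cone inequality is tight:
    \<open>q * exp (r / q)\<close> equals \<open>q / (- \<mu>)\<close>, which is the marginal by
    \<open>qM\<close>.\<close>
  have K: "(- (q x y z * ln (- \<mu> x y z)), marg_yz q y z, q x y z) \<in> K_exp" for x y z
  proof (cases "q x y z = 0")
    case True
    then show ?thesis
      using q by (simp add: K_exp_def marg_yz_def sum_nonneg)
  next
    case False
    then have "q x y z > 0"
      using q[of x y z] by simp
    moreover have "q x y z * exp (- ln (- \<mu> x y z)) = marg_yz q y z"
      using \<mu>[of x y z] qM[of x y z] by (simp add: exp_minus field_simps)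
    ultimately show ?thesis
      by (simp add: K_exp_def)
  qed
  have slack: "q x y z * ln (- \<mu> x y z)
      = - (q x y z * (lY x y + lZ x z)) - (q x y z * marg_yz \<mu> y z + q x y z)" for x y z
  proof -
    have "q x y z * (lY x y + lZ x z + marg_yz \<mu> y z + 1 + ln (- \<mu> x y z)) = 0"
      using w(2)[of x y z] by (simp add: q_def)
    then show ?thesis
      by (simp add: algebra_simps)
  qed
  \<comment> \<open>After the marginal is moved onto \<open>q\<close>, each summand is zero by
    \<open>qM\<close>.\<close>
  have "sum_xyz (\<lambda>x y z. q x y z * marg_yz \<mu> y z + q x y z)
      = sum_xyz (\<lambda>x y z. \<mu> x y z * marg_yz q y z + q x y z)"
    by (simp only: sum_xyz_add sum_xyz_marg_yz_swap[of q])
  also have "\<dots> = 0"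
    using qM by (simp add: sum_xyz_def)
  finally have zero: "sum_xyz (\<lambda>x y z. q x y z * marg_yz \<mu> y z + q x y z) = 0" .
  show thesis
  proof
    show "EXP_feasible bY bZ (\<lambda>x y z. - (q x y z * ln (- \<mu> x y z)), \<lambda>x y z. marg_yz q y z, q)"
      using K by (simp add: EXP_feasible_def qY qZ)
    have "EXP_objective (\<lambda>x y z. - (q x y z * ln (- \<mu> x y z)), \<lambda>x y z. marg_yz q y z, q)
        = sum_xyz (\<lambda>x y z. - (q x y z * (lY x y + lZ x z)) - (q x y z * marg_yz \<mu> y z + q x y z))"
      by (simp only: EXP_objective_def prod.case sum_xyz_uminus minus_minus slack[symmetric])
    also have "\<dots> = DEXP_objective bY bZ (lY, lZ, \<mu>)"
      unfolding sum_xyz_diff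
      using zero by (simp add: sum_xyz_uminus DEXP_objective_marg[of q bY bZ, OF qY qZ])
    finally show "EXP_objective (\<lambda>x y z. - (q x y z * ln (- \<mu> x y z)), \<lambda>x y z. marg_yz q y z, q)
        = DEXP_objective bY bZ (lY, lZ, \<mu>)" .
  qed
qed

section \<open>Joint optimality and zero gap\<close>

theorem proposition5:
  fixes P :: "'x::finite \<Rightarrow> 'y::finite \<Rightarrow> 'z::finite \<Rightarrow> real"
    and bY :: "'x \<Rightarrow> 'y \<Rightarrow> real"
    and bZ :: "'x \<Rightarrow> 'z \<Rightarrow> real"
    and r p q \<mu> :: "'x \<Rightarrow> 'y \<Rightarrow> 'z \<Rightarrow> real"
    and lY :: "'x \<Rightarrow> 'y \<Rightarrow> real"
    and lZ :: "'x \<Rightarrow> 'z \<Rightarrow> real"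
  assumes "prob_distribution P"
    and "\<And>x y. bY x y = marg_xy P x y"
    and "\<And>x z. bZ x z = marg_xz P x z"
    and "EXP_feasible bY bZ (r, p, q)"
    and "DEXP_feasible (lY, lZ, \<mu>)"
  shows "EXP_optimal bY bZ (r, p, q) \<and> DEXP_optimal bY bZ (lY, lZ, \<mu>) \<longleftrightarrow>
    - (\<Sum>x\<in>UNIV. \<Sum>y\<in>UNIV. \<Sum>z\<in>UNIV. r x y z)
    + (\<Sum>x\<in>UNIV. \<Sum>y\<in>UNIV. lY x y * bY x y)
    + (\<Sum>x\<in>UNIV. \<Sum>z\<in>UNIV. lZ x z * bZ x z) = 0"
proof -
  let ?P = "EXP_objective :: ('x, 'y, 'z) exp_point \<Rightarrow> real"
  let ?D = "DEXP_objective bY bZ"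
  have weak: "?D l \<le> ?P s" if "EXP_feasible bY bZ s" "DEXP_feasible l" for s l
    using that weak_duality[of bY bZ] by (cases s; cases l) blast
  have "EXP_optimal bY bZ (r, p, q) \<and> DEXP_optimal bY bZ (lY, lZ, \<mu>)
      \<longleftrightarrow> ?P (r, p, q) = ?D (lY, lZ, \<mu>)"
  proof (intro iffI conjI)
    \<comment> \<open>A feasible primal point attains the dual optimum, so the primal optimum is at
      most that value; weak duality gives the reverse.\<close>
    assume opt: "EXP_optimal bY bZ (r, p, q) \<and> DEXP_optimal bY bZ (lY, lZ, \<mu>)"
    then obtain r' p' q' where s: "EXP_feasible bY bZ (r', p', q')"
      "?P (r', p', q') = ?D (lY, lZ, \<mu>)"
      using primal_from_dual_optimal[of bY bZ lY lZ \<mu>] by blast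
    have "\<not> ?P (r', p', q') < ?P (r, p, q)"
      using opt s(1) unfolding EXP_optimal_def is_arg_min_def by blast
    then have "?P (r, p, q) \<le> ?D (lY, lZ, \<mu>)"
      using s(2) by simp
    with weak[OF assms(4,5)] show "?P (r, p, q) = ?D (lY, lZ, \<mu>)"
      by simp
  next
    \<comment> \<open>By weak duality each of the two points bounds all competitors of the other,
      and the common value attains both bounds.\<close>
    assume eq: "?P (r, p, q) = ?D (lY, lZ, \<mu>)"
    show "EXP_optimal bY bZ (r, p, q)"
      using assms(4) weak[OF _ assms(5)] eq by (auto simp: EXP_optimal_def is_arg_min_def not_less)
    show "DEXP_optimal bY bZ (lY, lZ, \<mu>)"
      using assms(5) weak[OF assms(4)] eq by (auto simp: DEXP_optimal_def is_arg_max_def not_less)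
  qed
  then show ?thesis
    by (simp add: EXP_objective_def DEXP_objective_def sum_xyz_def algebra_simps)
qed

end
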